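(* Let $\ell \geq 3$ and let $G$ be a disperse $\ell$-graph. Then $G$ or its complement $\overline{G}$ is not tightly connected.
   Context: An $\ell$-graph $G$ is an $\ell$-uniform hypergraph with vertex set $V(G)$ and edge set $E(G) \subseteq \binom{V(G)}{\ell}$. Its complement $\overline{G}$ is the $\ell$-graph on $V(G)$ with edge set $\binom{V(G)}{\ell} \setminus E(G)$. For $X \subseteq V(G)$, $e_G(X)$ is the number of edges of $G$ contained in $X$. For $\ell \geq 3$, an $\ell$-graph $G$ is disperse if $e_G(X) \in \{0, 1, \ell, \ell+1\}$ for every $(\ell+1)$-set $X \subseteq V(G)$. A tight walk in $G$ is a sequence of edges $e_1, \dots, e_m \in E(G)$ such that $|e_i \cap e_{i+1}| \geq \ell-1$ for all $1 \leq i \leq m-1$. Sets $A, B \in \binom{V(G)}{\ell-1}$ are connected in $G$ if there is a tight walk $e_1, \dots, e_m$ in $G$ with $A \subseteq e_1$ and $B \subseteq e_m$. This is an equivalence relation, and its equivalence classes are called the tight components of $G$; thus the tight components partition $\binom{V(G)}{\ell-1}$. $G$ is tightly connected if there is a single tight component, namely $\binom{V(G)}{\ell-1}$; in other words, if for every $A, B \in \binom{V(G)}{\ell-1}$ there is a tight walk $e_1, \dots, e_m$ in $G$ with $A \subseteq e_1$ and $B \subseteq e_m$.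
   Formalization: The vertex set of G is assumed finite (for infinite vertex sets the statement fails), and "tightly connected" requires at least one (ℓ−1)-set, with every (ℓ−1)-set lying in an edge, so graphs with fewer than ℓ vertices do not count as tightly connected. *)

theory Defs
  imports Main "HOL-Library.Ramsey"
begin

text \<open>
  An \<open>l\<close>-graph is given by its vertex set \<open>V\<close> and its edge set \<open>E\<close>; as usual in this area, it is
  finite.
\<close>

definition uniform_hypergraph :: "nat \<Rightarrow> 'a set \<Rightarrow> 'a set set \<Rightarrow> bool" where
  "uniform_hypergraph l V E \<longleftrightarrow> finite V \<and> E \<subseteq> nsets V l"

definition complement_edges :: "nat \<Rightarrow> 'a set \<Rightarrow> 'a set set \<Rightarrow> 'a set set" where
  "complement_edges l V E = nsets V l - E"

definition edges_within :: "'a set set \<Rightarrow> 'a set \<Rightarrow> nat" where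
  "edges_within E X = card {e \<in> E. e \<subseteq> X}"

definition disperse :: "nat \<Rightarrow> 'a set \<Rightarrow> 'a set set \<Rightarrow> bool" where
  "disperse l V E \<longleftrightarrow> (\<forall>X \<in> nsets V (l + 1). edges_within E X \<in> {0, 1, l, l + 1})"

definition tight_walk :: "nat \<Rightarrow> 'a set set \<Rightarrow> 'a set list \<Rightarrow> bool" where
  "tight_walk l E es \<longleftrightarrow> es \<noteq> [] \<and> set es \<subseteq> E \<and>
     (\<forall>i. i + 1 < length es \<longrightarrow> card (es ! i \<inter> es ! (i + 1)) \<ge> l - 1)"

definition tight_conn :: "nat \<Rightarrow> 'a set \<Rightarrow> 'a set set \<Rightarrow> ('a set \<times> 'a set) set" where
  "tight_conn l V E = {(A, B). A \<in> nsets V (l - 1) \<and> B \<in> nsets V (l - 1) \<and>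
     (\<exists>es. tight_walk l E es \<and> A \<subseteq> hd es \<and> B \<subseteq> last es)}"

text \<open>
  Tight connectedness asks for a single tight component that is all of \<open>nsets V (l - 1)\<close>. Since an
  equivalence class is nonempty, this excludes \<open>nsets V (l - 1) = {}\<close>, i.e. \<open>card V < l - 1\<close>. A walk
  has at least one edge, so an \<open>(l - 1)\<close>-set contained in no edge is not joined even to itself; in
  particular an edgeless graph is never tightly connected.
\<close>

definition tightly_connected :: "nat \<Rightarrow> 'a set \<Rightarrow> 'a set set \<Rightarrow> bool" where
  "tightly_connected l V E \<longleftrightarrow> nsets V (l - 1) \<noteq> {} \<and>
     (\<forall>A \<in> nsets V (l - 1). \<forall>B \<in> nsets V (l - 1). (A, B) \<in> tight_conn l V E)"

lemma tightly_connected_iff_single_component: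
  "tightly_connected l V E \<longleftrightarrow> nsets V (l - 1) // tight_conn l V E = {nsets V (l - 1)}"
proof -
  let ?N = "nsets V (l - 1)" and ?r = "tight_conn l V E"
  have sub: "?r `` {A} \<subseteq> ?N" for A
    by (auto simp: tight_conn_def)
  show ?thesis
  proof
    assume tc: "tightly_connected l V E"
    then have "?r `` {A} = ?N" if "A \<in> ?N" for A
      using sub[of A] that unfolding tightly_connected_def by blast
    moreover have "?N \<noteq> {}"
      using tc by (simp add: tightly_connected_def)
    ultimately show "?N // ?r = {?N}"
      unfolding quotient_def by blast
  next
    assume q: "?N // ?r = {?N}"
    then have "?N \<noteq> {}"
      by (auto simp: quotient_def)
    moreover have "?r `` {A} = ?N" if "A \<in> ?N" for A
      using q quotientI[OF that, of ?r] by simp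
    ultimately show "tightly_connected l V E"
      unfolding tightly_connected_def by blast
  qed
qed

end

theory Submission
  imports Defs
begin

text \<open>
  Colour the \<open>l\<close>-sets red (edges) and blue (non-edges); every \<open>(l + 1)\<close>-set has at most one red or at
  most one blue subset. The majority colours of the \<open>(l + 1)\<close>-sets inherit this property one
  uniformity higher, and iterating this shows that two \<open>(l - 1)\<close>-sets \<open>A\<close>, \<open>U\<close> cannot be
  such that \<open>A + u\<close> is blue for all \<open>u \<in> U - A\<close> and \<open>U + a\<close> is red for all \<open>a \<in> A - U\<close>. So if all
  \<open>U + a\<close> with \<open>a \<in> W - U\<close> are red, every \<open>(l - 1)\<close>-subset of \<open>W\<close> can be moved to \<open>U\<close> through red
  edges inside \<open>W\<close>.

  The theorem follows by induction on the vertices. Let \<open>P\<close> be a nontrivial union of red components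
  after deleting a vertex \<open>v\<close>. If \<open>P\<close> does not extend to \<open>v\<close>, two adjacent red edges
  \<open>v + A\<close>, \<open>v + A'\<close> separate \<open>A\<close> from \<open>A'\<close> by \<open>P\<close>, which makes \<open>A \<union> A'\<close> a clique in the red link of
  \<open>v\<close>. Let \<open>K\<close> be a maximal such clique. If \<open>K\<close> is everything, no blue edge contains \<open>v\<close>; otherwise
  every \<open>l\<close>-set meeting \<open>K + v\<close> in exactly \<open>l - 1\<close> vertices turns out to be blue, so the
  \<open>(l - 1)\<close>-subsets of \<open>K + v\<close> are separated from the others in red.
\<close>

lemma delete_point_obtain:
  assumes "finite B" "S \<subseteq> B" "card B = Suc (card S)"
  obtains b where "b \<in> B" "S = B - {b}"
proof -
  have "card (B - S) = 1"
    using assms by (simp add: card_Diff_subset finite_subset)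
  then obtain b where "B - S = {b}"
    by (auto simp: card_1_singleton_iff)
  then show thesis
    using assms that[of b] by blast
qed

section \<open>Two-colourings with at most one exceptional subset\<close>

text \<open>A colour-symmetric form of dispersion that can be iterated, \<open>R\<close> being any
  colouring. An \<open>n\<close>-subset of \<open>X\<close> is named by the vertex it omits.\<close>

definition disp :: "nat \<Rightarrow> 'a set \<Rightarrow> ('a set \<Rightarrow> bool) \<Rightarrow> bool" where
  "disp n V R \<longleftrightarrow> (\<forall>X \<subseteq> V. card X = Suc n \<longrightarrow>
     \<not> (\<exists>a\<in>X. \<exists>b\<in>X. \<exists>c\<in>X. \<exists>d\<in>X. a \<noteq> b \<and> c \<noteq> d \<and>
        R (X - {a}) \<and> R (X - {b}) \<and> \<not> R (X - {c}) \<and> \<not> R (X - {d})))"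

text \<open>Under \<open>disp n V R\<close> with \<open>n \<ge> 3\<close>, two red subsets leave at
  most one blue one, so on \<open>(n + 1)\<close>-subsets of \<open>V\<close> this is the majority
  colour.\<close>

definition majority :: "('a set \<Rightarrow> bool) \<Rightarrow> 'a set \<Rightarrow> bool" where
  "majority R X \<longleftrightarrow> (\<exists>a\<in>X. \<exists>b\<in>X. a \<noteq> b \<and> R (X - {a}) \<and> R (X - {b}))"

lemma dispD:
  assumes "disp n V R" "X \<subseteq> V" "card X = Suc n" "a \<in> X" "b \<in> X" "c \<in> X" "d \<in> X"
    "a \<noteq> b" "c \<noteq> d" "R (X - {a})" "R (X - {b})" "\<not> R (X - {c})"
  shows "R (X - {d})"
  using assms unfolding disp_def by blast

lemma disp_Not: "disp n V (\<lambda>X. \<not> R X) \<longleftrightarrow> disp n V R"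
  unfolding disp_def by meson

lemma disp_subset: "disp n V R \<Longrightarrow> W \<subseteq> V \<Longrightarrow> disp n W R"
  unfolding disp_def by (meson subset_trans)

text \<open>Suppose omitting \<open>a\<close>, \<open>b\<close> leaves red majorities and omitting
  \<open>c\<close>, \<open>d\<close> blue ones; a fifth vertex \<open>e\<close>, available as
  \<open>n \<ge> 3\<close>, joins one side. Colour a pair like the \<open>n\<close>-set that omits
  it. Each red-majority vertex is in at most one blue pair, each blue-majority vertex in at most one
  red pair, so at most 2 + 3 = 5 of the 6 pairs across have a colour.\<close>

lemma disp_majority:
  assumes "disp n V R" "n \<ge> 3"
  shows "disp (Suc n) V (majority R)"
proof -
  have False
    if X: "X \<subseteq> V" "card X = Suc (Suc n)" and in_X: "a \<in> X" "b \<in> X" "c \<in> X" "d \<in> X"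
      and ne: "a \<noteq> b" "c \<noteq> d"
      and maj: "majority R (X - {a})" "majority R (X - {b})"
        "\<not> majority R (X - {c})" "\<not> majority R (X - {d})" for X a b c d
  proof -
    have fin: "finite X"
      using X(2) by (metis card.infinite nat.distinct(1))
    have "card {a, b, c, d} \<le> 4"
      by (simp add: card_insert_if)
    moreover have "card X > 4"
      using X assms by simp
    ultimately obtain e where e: "e \<in> X" "e \<notin> {a, b, c, d}"
      by (metis card_mono finite.emptyI finite.insertI leD le_less_trans subsetI)
    have dist: "a \<noteq> c" "a \<noteq> d" "b \<noteq> c" "b \<noteq> d"
      using maj by auto
    define g where "g x y \<longleftrightarrow> R (X - {x} - {y})" for x y
    have g_sym: "g x y \<longleftrightarrow> g y x" for x y
      unfolding g_def by (simp add: Diff_insert2 [symmetric] insert_commute)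
    have red: "g x y \<or> g x z"
      if "majority R (X - {x})" "x \<in> X" "y \<in> X - {x}" "z \<in> X - {x}" "y \<noteq> z" for x y z
    proof -
      have card: "card (X - {x}) = Suc n"
        using that X fin by simp
      obtain p p' where p: "p \<in> X - {x}" "p' \<in> X - {x}" "p \<noteq> p'"
        "R (X - {x} - {p})" "R (X - {x} - {p'})"
        using \<open>majority R (X - {x})\<close> unfolding majority_def by blast
      have "X - {x} \<subseteq> V"
        using X by blast
      from dispD[OF assms(1) this card p(1,2) that(3,4) p(3) that(5) p(4,5)] show ?thesis
        unfolding g_def by blast
    qed
    have blue: "\<not> g x y \<or> \<not> g x z"
      if "\<not> majority R (X - {x})" "y \<in> X - {x}" "z \<in> X - {x}" "y \<noteq> z" for x y z
      using that unfolding g_def majority_def by blast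
    have in_rest: "x \<in> X - {y}" if "x \<in> X" "x \<noteq> y" for x y
      using that by simp
    have ne': "c \<noteq> a" "d \<noteq> a" "c \<noteq> b" "d \<noteq> b" "e \<noteq> a" "e \<noteq> b" "e \<noteq> c" "e \<noteq> d"
      "a \<noteq> e" "b \<noteq> e" "c \<noteq> e" "d \<noteq> e" "b \<noteq> a" "d \<noteq> c"
      using dist ne e by auto
    note facts = in_rest in_X e(1) dist ne ne'
    note syms = g_sym[of a c] g_sym[of a d] g_sym[of a e] g_sym[of b c] g_sym[of b d] g_sym[of b e]
      g_sym[of c e] g_sym[of d e]
    show False
    proof (cases "majority R (X - {e})")
      case True
      have "g a c \<or> g a d" "g b c \<or> g b d" "g e c \<or> g e d"
        using maj True by (intro red facts; simp)+
      moreover have "\<not> g c a \<or> \<not> g c b" "\<not> g c a \<or> \<not> g c e" "\<not> g c b \<or> \<not> g c e"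
        "\<not> g d a \<or> \<not> g d b" "\<not> g d a \<or> \<not> g d e" "\<not> g d b \<or> \<not> g d e"
        using maj by (intro blue facts; simp)+
      ultimately show ?thesis
        using syms by argo
    next
      case False
      have "\<not> g c a \<or> \<not> g c b" "\<not> g d a \<or> \<not> g d b" "\<not> g e a \<or> \<not> g e b"
        using maj False by (intro blue facts; simp)+
      moreover have "g a c \<or> g a d" "g a c \<or> g a e" "g a d \<or> g a e"
        "g b c \<or> g b d" "g b c \<or> g b e" "g b d \<or> g b e"
        using maj by (intro red facts; simp)+
      ultimately show ?thesis
        using syms by argo
    qed
  qed
  then show ?thesis
    unfolding disp_def by blast
qed

text \<open>Replace \<open>A\<close>, \<open>U\<close> by \<open>A + u\<close>, \<open>U + a\<close>
  and \<open>R\<close> by \<open>majority R\<close>: both star conditions survive, while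
  \<open>U - A\<close> loses \<open>u\<close>. The descent ends when \<open>A + u = U + a\<close>, a
  single set that would have both colours.\<close>

lemma no_opposite_stars:
  assumes "disp (Suc q) V R" "q \<ge> 2" "A \<subseteq> V" "U \<subseteq> V" "card A = q" "card U = q" "A \<noteq> U"
    and "\<And>u. u \<in> U - A \<Longrightarrow> \<not> R (insert u A)" "\<And>a. a \<in> A - U \<Longrightarrow> R (insert a U)"
  shows False
  using assms
proof (induction "card (U - A)" arbitrary: q R A U rule: less_induct)
  case less
  have fin: "finite A" "finite U"
    using less.prems by (metis card.infinite not_numeral_le_zero)+
  have "\<not> U \<subseteq> A" "\<not> A \<subseteq> U"
    using less.prems fin by (metis card_subset_eq)+
  then obtain u a where u: "u \<in> U - A" and a: "a \<in> A - U"
    by blast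
  show False
  proof (cases "insert u A = insert a U")
    case True
    then show ?thesis
      using less.prems(8)[OF u] less.prems(9)[OF a] by simp
  next
    case False
    have blue: "\<not> majority R (insert y (insert u A))" if y: "y \<in> insert a U - insert u A" for y
    proof
      let ?X = "insert y (insert u A)"
      have y': "y \<in> U - A" "y \<noteq> u"
        using y a by auto
      have "?X - {u} = insert y A" "?X - {y} = insert u A"
        using y' u by auto
      then have b: "\<not> R (?X - {u})" "\<not> R (?X - {y})"
        using less.prems(8) u y' by auto
      have X: "?X \<subseteq> V" "card ?X = Suc (Suc q)"
        using y' u less.prems fin by auto
      assume "majority R ?X"
      then show False
        using dispD[OF less.prems(1) X] b y' unfolding majority_def
        by (metis insertI1 insertI2)
    qed
    have red: "majority R (insert x (insert a U))" if x: "x \<in> insert u A - insert a U" for x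
    proof -
      let ?X = "insert x (insert a U)"
      have x': "x \<in> A - U" "x \<noteq> a"
        using x u by auto
      have "?X - {a} = insert x U" "?X - {x} = insert a U"
        using x' a by auto
      then show ?thesis
        using less.prems(9) a x' unfolding majority_def by (metis insertI1 insertI2)
    qed
    have "insert a U - insert u A = (U - A) - {u}"
      using a by auto
    then have "card (insert a U - insert u A) < card (U - A)"
      using u fin by (metis card_Diff1_less finite_Diff)
    moreover have "disp (Suc (Suc q)) V (majority R)"
      using disp_majority[OF less.prems(1)] less.prems(2) by simp
    ultimately show ?thesis
      using less.hyps[of "insert a U" "insert u A" "Suc q" "majority R"] less.prems fin u a False
        blue red by auto
  qed
qed

text \<open>Describes a union of red tight components as an invariant: \<open>P\<close> cannot
  change along a red tight walk. Sets in no red edge may take either value.\<close>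

definition component_union :: "('a set \<Rightarrow> bool) \<Rightarrow> nat \<Rightarrow> 'a set \<Rightarrow> ('a set \<Rightarrow> bool) \<Rightarrow> bool" where
  "component_union P n V R \<longleftrightarrow>
     (\<forall>e \<subseteq> V. card e = n \<longrightarrow> R e \<longrightarrow> (\<forall>x\<in>e. \<forall>y\<in>e. P (e - {x}) = P (e - {y})))"

lemma component_unionD:
  "component_union P n V R \<Longrightarrow> e \<subseteq> V \<Longrightarrow> card e = n \<Longrightarrow> R e \<Longrightarrow> x \<in> e \<Longrightarrow> y \<in> e \<Longrightarrow>
    P (e - {x}) = P (e - {y})"
  unfolding component_union_def by blast

text \<open>By \<open>no_opposite_stars\<close>, some \<open>A + u\<close> with
  \<open>u \<in> U - A\<close> is red; exchanging \<open>a \<in> A - U\<close> for \<open>u\<close>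
  inside this edge keeps \<open>P\<close> and brings \<open>A\<close> closer to
  \<open>U\<close>.\<close>

lemma component_union_constant_if_red_star:
  assumes "disp (Suc q) W R" "q \<ge> 2" "component_union P (Suc q) W R" "U \<subseteq> W" "card U = q"
    and red: "\<And>a. a \<in> W - U \<Longrightarrow> R (insert a U)"
    and "A \<subseteq> W" "card A = q"
  shows "P A = P U"
  using assms(7,8)
proof (induction "card (U - A)" arbitrary: A rule: less_induct)
  case less
  have fin: "finite A" "finite U"
    using less.prems assms by (metis card.infinite not_numeral_le_zero)+
  show ?case
  proof (cases "A = U")
    case False
    then obtain u where u: "u \<in> U - A" "R (insert u A)"
      using no_opposite_stars[of q W R A U] assms less.prems by blast
    obtain a where a: "a \<in> A - U"
      using False less.prems fin assms by (metis DiffI card_subset_eq subsetI)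
    let ?A = "insert u A - {a}"
    have "U - ?A = (U - A) - {u}"
      using a by auto
    then have "card (U - ?A) < card (U - A)"
      using u fin by (metis card_Diff1_less finite_Diff)
    moreover have "?A \<subseteq> W" "card ?A = q"
      using u a less.prems fin assms by auto
    ultimately have "P ?A = P U"
      using less.hyps by blast
    moreover have "P (insert u A - {a}) = P (insert u A - {u})"
      using u a less.prems fin assms by (intro component_unionD[OF assms(3)]) auto
    moreover have "insert u A - {u} = A"
      using u by auto
    ultimately show ?thesis by simp
  qed simp
qed

section \<open>Cliques in the red link of a vertex\<close>

text \<open>Connectivity of the Johnson graph on \<open>S\<close>.\<close>

lemma exchange_induct:
  assumes "finite S" "A \<subseteq> S" "B \<subseteq> S" "card A = card B" "Q A"
    and step: "\<And>C x y. C \<subseteq> S \<Longrightarrow> card C = card A \<Longrightarrow> Q C \<Longrightarrow> x \<in> C \<Longrightarrow> y \<in> S - C \<Longrightarrow>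
      Q (insert y (C - {x}))"
  shows "Q B"
proof -
  have "Q B" if "C \<subseteq> S" "card C = card A" "Q C" for C
    using that
  proof (induction "card (B - C)" arbitrary: C rule: less_induct)
    case less
    have fin: "finite C" "finite B"
      using assms less.prems finite_subset by metis+
    show ?case
    proof (cases "C = B")
      case False
      then have "\<not> C \<subseteq> B" "\<not> B \<subseteq> C"
        using less.prems fin assms by (metis card_subset_eq)+
      then obtain x y where x: "x \<in> C - B" and y: "y \<in> B - C"
        by blast
      let ?C = "insert y (C - {x})"
      have "B - ?C = (B - C) - {y}"
        using x by auto
      then have "card (B - ?C) < card (B - C)"
        using y fin by (metis card_Diff1_less finite_Diff)
      moreover have "?C \<subseteq> S"
        using y less.prems assms by auto
      moreover have "card ?C = card A"
        using card_Suc_Diff1[of C x] x y less.prems fin by simp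
      moreover have "Q ?C"
        using step[of C x y] less.prems x y assms by auto
      ultimately show ?thesis
        using less.hyps by blast
    qed (use less in simp)
  qed
  then show ?thesis
    using assms by blast
qed

text \<open>Serves to enlarge cliques: one red \<open>v + r + S0\<close> makes \<open>K + r\<close>
  a clique as well. If both colours occurred, they would force enough red edges avoiding
  \<open>v\<close> to make \<open>P\<close> agree on \<open>X - a\<close> and
  \<open>X - a'\<close>.\<close>

lemma link_clique_homogeneous:
  assumes disp: "disp (Suc q) (insert v V) R" and q: "q \<ge> 2" and fin: "finite V" and v: "v \<notin> V"
    and P: "component_union P (Suc q) V R"
    and K: "K \<subseteq> V" and clique: "\<And>A. A \<subseteq> K \<Longrightarrow> card A = q \<Longrightarrow> R (insert v A)"
    and r: "r \<in> V - K"
    and X: "X \<subseteq> K" "card X = Suc q" and a: "a \<in> X" "a' \<in> X" "P (X - {a}) \<noteq> P (X - {a'})"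
    and S0: "S0 \<subseteq> K" "Suc (card S0) = q" "R (insert v (insert r S0))"
    and T0: "T0 \<subseteq> K" "Suc (card T0) = q"
  shows "R (insert v (insert r T0))"
proof (rule ccontr)
  assume T0_blue: "\<not> R (insert v (insert r T0))"
  define f where "f T \<longleftrightarrow> R (insert v (insert r T))" for T
  have finK: "finite K"
    using K fin finite_subset by blast
  have subK: "finite Y" "r \<notin> Y" "v \<notin> Y" "Y \<subseteq> V" if "Y \<subseteq> K" for Y
    using that finK finite_subset K r v by auto
  have rv: "r \<noteq> v" "r \<in> V"
    using r v by auto
  have Z_props: "insert v (insert r Y) \<subseteq> insert v V" "card (insert v (insert r Y)) = Suc (Suc q)"
    "insert v (insert r Y) - {r} = insert v Y" "insert v (insert r Y) - {v} = insert r Y"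
    "y \<in> Y \<Longrightarrow> insert v (insert r Y) - {y} = insert v (insert r (Y - {y}))"
    if "Y \<subseteq> K" "card Y = q" for Y y
    using that subK[OF that(1)] rv by auto
  \<comment> \<open>Among the subsets of \<open>Y + v + r\<close>, \<open>Y + v\<close> is red by
    the clique condition; two blue ones make it the only red one.\<close>
  have two_blue: "\<not> f (Y - {z})" "\<not> R (insert r Y)"
    if "Y \<subseteq> K" "card Y = q" "y \<in> Y" "y' \<in> Y" "y \<noteq> y'" "\<not> f (Y - {y})" "\<not> f (Y - {y'})" "z \<in> Y"
    for Y y y' z
  proof -
    let ?Z = "insert v (insert r Y)"
    note Z = Z_props[OF that(1,2)]
    have "\<not> R (?Z - {x})" if x: "x \<in> ?Z" "x \<noteq> r" for x
    proof
      assume "R (?Z - {x})"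
      moreover have "R (?Z - {r})"
        using clique[OF \<open>Y \<subseteq> K\<close> \<open>card Y = q\<close>] Z(3) by simp
      ultimately show False
        using dispD[OF disp Z(1,2), of x r y y'] x Z(5) \<open>y \<in> Y\<close> \<open>y' \<in> Y\<close> \<open>y \<noteq> y'\<close>
          \<open>\<not> f (Y - {y})\<close> \<open>\<not> f (Y - {y'})\<close>
        unfolding f_def by auto
    qed
    from this[of z] this[of v] show "\<not> f (Y - {z})" "\<not> R (insert r Y)"
      using Z(4,5) that(8) subK[OF that(1)] rv unfolding f_def by auto
  qed
  \<comment> \<open>Here \<open>Y + v\<close> and one further subset are red and one is blue, so no
    second one is blue.\<close>
  have mixed: "R (insert r Y)"
    if "Y \<subseteq> K" "card Y = q" "y \<in> Y" "z \<in> Y" "\<not> f (Y - {y})" "f (Y - {z})" for Y y z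
  proof -
    note Z = Z_props[OF that(1,2)]
    show ?thesis
      using dispD[OF disp Z(1,2), of r z y v] Z(3-5) clique that subK[OF that(1)] rv
      unfolding f_def by auto
  qed

  txt \<open>
    Take \<open>B\<close> maximal such that \<open>f\<close> fails on all its \<open>(q - 1)\<close>-subsets \<open>T\<close>. By maximality \<open>T + r + s\<close>
    is red for all \<open>s \<in> K - B\<close>, so \<open>T + r\<close> is the centre of a red star on \<open>(K - B) \<union> T \<union> {r}\<close> and
    \<open>P\<close> is constant there. This excludes \<open>|X \<inter> B| < q\<close>; if \<open>X\<close> meets \<open>B\<close> in more vertices, red edges
    \<open>Y + s\<close> with \<open>Y \<subseteq> B\<close> take over.
  \<close>
  define good where
    "good B \<longleftrightarrow> T0 \<subseteq> B \<and> B \<subseteq> K \<and> (\<forall>T. T \<subseteq> B \<longrightarrow> Suc (card T) = q \<longrightarrow> \<not> f T)" for B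
  have "good T0"
    unfolding good_def f_def using T0 T0_blue subK(1)[OF T0(1)]
    by (metis Suc_inject card_subset_eq subset_refl)
  moreover have "finite {B. good B}"
    by (rule finite_subset[of _ "Pow K"]) (auto simp: good_def finK)
  ultimately obtain B where B: "good B" and B_max: "\<And>C. good C \<Longrightarrow> B \<subseteq> C \<Longrightarrow> B = C"
    using finite_has_maximal2[of "{B. good B}" T0] by auto
  have BK: "B \<subseteq> K" and T0B: "T0 \<subseteq> B" and B_blue: "\<And>T. T \<subseteq> B \<Longrightarrow> Suc (card T) = q \<Longrightarrow> \<not> f T"
    using B unfolding good_def by auto
  have finB: "finite B"
    using BK subK by blast
  have "B \<noteq> K"
    using B_blue S0 unfolding f_def by blast
  then obtain s0 where s0: "s0 \<in> K - B"
    using BK by blast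

  have outside_red: "f (insert s T)" if s: "s \<in> K - B" and T: "T \<subseteq> B" "Suc (Suc (card T)) = q" for s T
  proof (rule ccontr)
    assume blue: "\<not> f (insert s T)"
    have "\<not> good (insert s B)"
      using B_max[of "insert s B"] s by auto
    then obtain T1 where T1: "T1 \<subseteq> insert s B" "Suc (card T1) = q" "f T1"
      unfolding good_def using BK s T0B by blast
    then have sT1: "s \<in> T1"
      using B_blue by blast
    have T2: "T1 - {s} \<subseteq> B" "card T = card (T1 - {s})"
      using T1 sT1 T finB finite_subset[OF T1(1)] by (auto simp: card_Diff_singleton)
    \<comment> \<open>Both \<open>s + C\<close> and \<open>y + C\<close> fail \<open>f\<close>
      inside \<open>s + y + C\<close>, so \<open>two_blue\<close> preserves the failure under every
      exchange, up to the set \<open>T1\<close> where \<open>f\<close> holds.\<close>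
    have "\<not> f (insert s (T1 - {s}))"
    proof (rule exchange_induct[where Q = "\<lambda>C. \<not> f (insert s C)", OF finB T(1) T2 blue])
      fix C x y assume C: "C \<subseteq> B" "card C = card T" "\<not> f (insert s C)" "x \<in> C" "y \<in> B - C"
      let ?Y = "insert s (insert y C)"
      have finC: "finite C"
        using C finB finite_subset by blast
      have "s \<notin> C" "y \<notin> C" "s \<noteq> y"
        using C s by auto
      then have Y: "?Y \<subseteq> K" "card ?Y = q"
        using C BK s T finC by auto
      have "?Y - {y} = insert s C" "?Y - {s} = insert y C" "?Y - {x} = insert s (insert y (C - {x}))"
        using C s by auto
      moreover have "\<not> f (insert y C)"
        using B_blue[of "insert y C"] C T finC by auto
      ultimately show "\<not> f (insert s (insert y (C - {x})))"
        using two_blue(1)[OF Y, of y s x] C s by auto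
    qed
    then show False
      using T1 sT1 by (simp add: insert_absorb)
  qed
  have star: "R (insert r (insert s T))" if s: "s \<in> K - B" and T: "T \<subseteq> B" "Suc (card T) = q" for s T
  proof -
    have finT: "finite T"
      using T finB finite_subset by blast
    then obtain t where t: "t \<in> T"
      using T q by fastforce
    have "insert s T - {t} = insert s (T - {t})" "insert s T - {s} = T"
      using s t T by auto
    moreover have "T - {t} \<subseteq> B" "Suc (Suc (card (T - {t}))) = q"
      using T t card_Suc_Diff1[OF finT t] by auto
    then have "f (insert s (T - {t}))"
      by (rule outside_red[OF s])
    moreover have "s \<notin> T"
      using s T by auto
    then have "insert s T \<subseteq> K" "card (insert s T) = q"
      using s T BK finT by auto
    ultimately show ?thesis
      using mixed[of "insert s T" s t] t B_blue[OF T] by simp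
  qed
  \<comment> \<open>In \<open>Y + r + s\<close> the subsets omitting a point of \<open>Y\<close> are
    red by \<open>star\<close>, at least two as \<open>q \<ge> 2\<close>. Since \<open>Y + r\<close>
    is blue, \<open>Y + s\<close> cannot be blue too.\<close>
  have joined: "R (insert s Y)" if s: "s \<in> K - B" and Y: "Y \<subseteq> B" "card Y = q" for s Y
  proof -
    have finY: "finite Y" and YK: "Y \<subseteq> K"
      using Y finB BK finite_subset by auto
    obtain y y' where y: "y \<in> Y" "y' \<in> Y" "y \<noteq> y'"
      using Y q by (metis card_le_Suc0_iff_eq finY not_less_eq_eq numeral_2_eq_2)
    let ?Z = "insert r (insert s Y)"
    have rn: "r \<notin> Y" "r \<noteq> s" "s \<notin> Y"
      using s Y YK r by auto
    have Z: "?Z \<subseteq> insert v V" "card ?Z = Suc (Suc q)"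
      using finY rn Y YK K rv s by auto
    have sub: "Y - {x} \<subseteq> B" "Suc (card (Y - {x})) = q" if "x \<in> Y" for x
      using Y card_Suc_Diff1[OF finY that] by auto
    have red: "R (?Z - {x})" if "x \<in> Y" for x
    proof -
      have "?Z - {x} = insert r (insert s (Y - {x}))"
        using that rn by auto
      then show ?thesis
        using star[OF s sub[OF that]] by simp
    qed
    have "\<not> f (Y - {x})" if "x \<in> Y" for x
      by (rule B_blue[OF sub[OF that]])
    then have "\<not> R (insert r Y)"
      using two_blue(2)[OF YK Y(2) y(1,2,3)] y by blast
    moreover have "?Z - {s} = insert r Y" "?Z - {r} = insert s Y"
      using rn by auto
    ultimately show ?thesis
      using dispD[OF disp Z, of y y' s r] red y rn by auto
  qed

  have finX: "finite X"
    using X subK by blast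
  have "a \<noteq> a'"
    using a by auto
  consider "card (X \<inter> B) < q" | "card (X \<inter> B) = q" | "card (X \<inter> B) > q"
    by linarith
  then show False
  proof cases
    case 1
    \<comment> \<open>This is why \<open>good\<close> demands \<open>T0 \<subseteq> B\<close>:
      \<open>B\<close> must have enough points to enlarge \<open>X \<inter> B\<close> to
      \<open>T\<close>.\<close>
    have "q - 1 \<le> card B" "card (X \<inter> B) \<le> q - 1"
      using T0 card_mono[OF finB T0B] 1 by auto
    then obtain T where T: "X \<inter> B \<subseteq> T" "T \<subseteq> B" "card T = q - 1"
      using exists_subset_between[of "X \<inter> B" "q - 1" B] finB by blast
    define W where "W = insert r (T \<union> (K - B))"
    have finT: "finite T" and rT: "r \<notin> T"
      using T finB finite_subset BK r by auto
    have WV: "W \<subseteq> V"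
      using T BK K rv unfolding W_def by auto
    have "P A = P (insert r T)" if "A \<subseteq> W" "card A = q" for A
    proof (rule component_union_constant_if_red_star[OF _ q _ _ _ _ that])
      show "disp (Suc q) W R"
        using disp disp_subset WV by blast
      show "component_union P (Suc q) W R"
        using P WV unfolding component_union_def by (meson subset_trans)
      show "card (insert r T) = q"
        using T q finT rT by simp
      show "R (insert b (insert r T))" if "b \<in> W - insert r T" for b
        using star[of b T] that T q unfolding W_def by (auto simp: insert_commute)
    qed (auto simp: W_def)
    moreover have "X \<subseteq> W"
      using X T unfolding W_def by auto
    ultimately show False
      using a X finX by (metis Diff_subset card_Diff_singleton diff_Suc_1 subset_trans)
  next
    case 2
    obtain s where s: "s \<in> X" "X \<inter> B = X - {s}"
      using delete_point_obtain[OF finX, of "X \<inter> B"] 2 X by auto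
    then have "insert s (X \<inter> B) = X" "s \<in> K - B"
      using X(1) by auto
    then have "R X"
      using joined[of s "X \<inter> B"] 2 by auto
    then show False
      using component_unionD[OF P _ X(2) _ a(1,2)] a X K by auto
  next
    case 3
    then have "X \<inter> B = X"
      using X finX by (metis Int_lower1 Suc_leI card_seteq)
    then have XB: "X \<subseteq> B"
      by auto
    \<comment> \<open>The red edges \<open>s0 + (X - a)\<close> and \<open>s0 + (X - a')\<close>
      share the \<open>q\<close>-set \<open>s0 + (X - a - a')\<close>, which transfers
      \<open>P\<close> between \<open>X - a\<close> and \<open>X - a'\<close>.\<close>
    let ?e = "\<lambda>x. insert s0 (X - {x})"
    have "P (X - {x}) = P (insert s0 (X - {x} - {y}))" if "x \<in> X" "y \<in> X" "x \<noteq> y" for x y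
    proof -
      have x: "X - {x} \<subseteq> B" "card (X - {x}) = q" "s0 \<notin> X"
        using X finX s0 XB that by auto
      have "?e x \<subseteq> V" "card (?e x) = Suc q"
        using x s0 BK K finX by auto
      from component_unionD[OF P this joined[OF s0 x(1,2)], of s0 y]
      have "P (?e x - {s0}) = P (?e x - {y})"
        using that by blast
      moreover have "?e x - {s0} = X - {x}" "?e x - {y} = insert s0 (X - {x} - {y})"
        using x that by auto
      ultimately show ?thesis by simp
    qed
    from this[of a a'] this[of a' a] show False
      using a \<open>a \<noteq> a'\<close> by (simp add: Diff_insert2 [symmetric] insert_commute)
  qed
qed

section \<open>Adding a vertex\<close>

text \<open>Disconnectedness witnessed by an invariant: no red tight walk joins the two
  \<open>q\<close>-sets that \<open>P\<close> separates.\<close>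

definition splits :: "nat \<Rightarrow> 'a set \<Rightarrow> ('a set \<Rightarrow> bool) \<Rightarrow> bool" where
  "splits q V R \<longleftrightarrow> (\<exists>P. component_union P (Suc q) V R \<and>
     (\<exists>A \<subseteq> V. \<exists>B \<subseteq> V. card A = q \<and> card B = q \<and> P A \<noteq> P B))"

lemma splitsI:
  assumes "component_union P (Suc q) V R" "A \<subseteq> V" "B \<subseteq> V" "card A = q" "card B = q" "P A" "\<not> P B"
  shows "splits q V R"
  using assms unfolding splits_def by metis

lemma splits_insert:
  assumes disp: "disp (Suc q) (insert v V) R" and q: "q \<ge> 2" and fin: "finite V" and v: "v \<notin> V"
    and card: "card V \<ge> Suc q" and splits: "splits q V R"
  shows "splits q (insert v V) R \<or> splits q (insert v V) (\<lambda>X. \<not> R X)"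
proof -
  obtain P where P: "component_union P (Suc q) V R"
    and nonconst: "\<exists>A \<subseteq> V. \<exists>B \<subseteq> V. card A = q \<and> card B = q \<and> P A \<noteq> P B"
    using splits unfolding splits_def by blast
  have finV: "finite A" if "A \<subseteq> V" for A
    using that fin finite_subset by blast
  show ?thesis
  proof (cases "\<exists>X \<subseteq> V. card X = Suc q \<and> (\<exists>a\<in>X. \<exists>a'\<in>X. R (insert v (X - {a})) \<and>
      R (insert v (X - {a'})) \<and> P (X - {a}) \<noteq> P (X - {a'}))")
    case False
    \<comment> \<open>A set through \<open>v\<close> inherits the value of \<open>P\<close> at any
      \<open>B\<close> whose red edge \<open>v + B\<close> contains it, and gets
      \<open>False\<close> if there is none. The choice of \<open>B\<close> is immaterial: two
      distinct such sets unite to a \<open>(q + 1)\<close>-set, where the case assumption makes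
      \<open>P\<close> agree.\<close>
    define P' where "P' A = (if v \<in> A
      then \<exists>B. B \<subseteq> V \<and> card B = q \<and> A - {v} \<subseteq> B \<and> R (insert v B) \<and> P B else P A)" for A
    have same: "P B = P B'"
      if "B \<subseteq> V" "card B = q" "S \<subseteq> B" "R (insert v B)" "B' \<subseteq> V" "card B' = q" "S \<subseteq> B'"
        "R (insert v B')" "Suc (card S) = q" for B B' S
    proof (cases "B = B'")
      case False
      have fins: "finite B" "finite B'" "finite S"
        using that finV finite_subset by auto
      have SB: "S \<subseteq> B" "card B = Suc (card S)" "S \<subseteq> B'" "card B' = Suc (card S)"
        using that by auto
      obtain b where "b \<in> B" "S = B - {b}"
        using delete_point_obtain[OF fins(1) SB(1,2)] by metis
      then have b: "B = insert b S" "b \<notin> S"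
        by auto
      obtain b' where "b' \<in> B'" "S = B' - {b'}"
        using delete_point_obtain[OF fins(2) SB(3,4)] by metis
      then have b': "B' = insert b' S" "b' \<notin> S"
        by auto
      have bb: "b \<noteq> b'"
        using b b' False by auto
      let ?X = "insert b (insert b' S)"
      have "?X - {b'} = B" "?X - {b} = B'"
        using b b' bb by auto
      moreover have "?X \<subseteq> V" "card ?X = Suc q"
        using that b b' bb fins by auto
      ultimately show ?thesis
        using \<open>\<not> (\<exists>X \<subseteq> V. _ X)\<close> that by (metis insertI1 insertI2)
    qed simp
    have "component_union P' (Suc q) (insert v V) R"
      unfolding component_union_def
    proof (intro allI impI ballI)
      fix e x y assume e: "e \<subseteq> insert v V" "card e = Suc q" "R e" and xy: "x \<in> e" "y \<in> e"
      have fe: "finite e"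
        using e by (metis card.infinite nat.distinct(1))
      show "P' (e - {x}) = P' (e - {y})"
      proof (cases "v \<in> e")
        case True
        have ev: "e - {v} \<subseteq> V" "card (e - {v}) = q" "insert v (e - {v}) = e"
          using e True fe by auto
        have "P' (e - {z}) = P (e - {v})" if z: "z \<in> e" for z
        proof (cases "z = v")
          case True
          then show ?thesis
            unfolding P'_def by simp
        next
          case False
          let ?S = "e - {z} - {v}"
          have S: "?S \<subseteq> e - {v}" "Suc (card ?S) = q"
            using False z \<open>v \<in> e\<close> fe e(2) q by auto
          have "P B = P (e - {v})" if "B \<subseteq> V" "card B = q" "?S \<subseteq> B" "R (insert v B)" for B
            using same[OF that ev(1,2) S(1) _ S(2)] ev e by simp
          then have "(\<exists>B. B \<subseteq> V \<and> card B = q \<and> ?S \<subseteq> B \<and> R (insert v B) \<and> P B) = P (e - {v})"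
            using S(1) ev e(3) by metis
          then show ?thesis
            unfolding P'_def using False \<open>v \<in> e\<close> by simp
        qed
        then show ?thesis
          using xy by simp
      next
        case False
        then show ?thesis
          using component_unionD[OF P _ e(2,3) xy] e unfolding P'_def by auto
      qed
    qed
    moreover have "P' A = P A" if "A \<subseteq> V" for A
      using that v unfolding P'_def by auto
    ultimately have "splits q (insert v V) R"
      unfolding splits_def using nonconst by (metis subset_insertI2)
    then show ?thesis ..
  next
    case True
    then obtain X a a' where X: "X \<subseteq> V" "card X = Suc q" and a: "a \<in> X" "a' \<in> X"
      and aR: "R (insert v (X - {a}))" "R (insert v (X - {a'}))" and aP: "P (X - {a}) \<noteq> P (X - {a'})"
      by blast
    have "\<not> R X"
      using component_unionD[OF P X _ a] aP by blast
    define clique where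
      "clique K \<longleftrightarrow> X \<subseteq> K \<and> K \<subseteq> V \<and> (\<forall>A. A \<subseteq> K \<longrightarrow> card A = q \<longrightarrow> R (insert v A))" for K
    \<comment> \<open>In \<open>v + X\<close> the subset \<open>X\<close> is blue and those omitting
      \<open>a\<close>, \<open>a'\<close> are red, so \<open>X\<close> is the only blue one.\<close>
    have "clique X"
      unfolding clique_def
    proof (intro conjI allI impI)
      fix A assume A: "A \<subseteq> X" "card A = q"
      obtain x where x: "x \<in> X" "A = X - {x}"
        using delete_point_obtain[of X A] A X finV by auto
      let ?Z = "insert v X"
      have vX: "v \<notin> X"
        using v X by auto
      have Z: "?Z \<subseteq> insert v V" "card ?Z = Suc (Suc q)"
        using X finV vX by auto
      have del: "?Z - {y} = insert v (X - {y})" if "y \<in> X" for y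
        using that vX by auto
      have "?Z - {v} = X" "a \<noteq> a'" "v \<noteq> x"
        using vX aP x by auto
      then have "R (?Z - {x})"
        using dispD[OF disp Z, of a a' v x] a aR \<open>\<not> R X\<close> x by (simp add: del)
      then have "R (insert v (X - {x}))"
        using del x by simp
      then show "R (insert v A)"
        using x by simp
    qed (use X in auto)
    moreover have "finite {K. clique K}"
      by (rule finite_subset[of _ "Pow V"]) (auto simp: clique_def fin)
    ultimately obtain K where K: "clique K" and K_max: "\<And>C. clique C \<Longrightarrow> K \<subseteq> C \<Longrightarrow> K = C"
      using finite_has_maximal2[of "{K. clique K}" X] by auto
    have XK: "X \<subseteq> K" and KV: "K \<subseteq> V" and KR: "\<And>A. A \<subseteq> K \<Longrightarrow> card A = q \<Longrightarrow> R (insert v A)"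
      using K unfolding clique_def by auto
    show ?thesis
    proof (cases "K = V")
      case True
      have "component_union (\<lambda>A. v \<in> A) (Suc q) (insert v V) (\<lambda>X. \<not> R X)"
        unfolding component_union_def
      proof (intro allI impI ballI)
        fix e x y assume e: "e \<subseteq> insert v V" "card e = Suc q" "\<not> R e"
        have "v \<notin> e"
        proof
          assume "v \<in> e"
          then have "e - {v} \<subseteq> V" "card (e - {v}) = q" "insert v (e - {v}) = e"
            using e by (auto simp: card_Diff_singleton)
          then show False
            using KR[of "e - {v}"] True e by simp
        qed
        then show "(v \<in> e - {x}) = (v \<in> e - {y})" by simp
      qed
      moreover have "q - 1 \<le> card V" "q \<le> card V"
        using card by auto
      then obtain A B where A: "A \<subseteq> V" "card A = q" and B: "B \<subseteq> V" "card B = q - 1" "finite B"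
        using obtain_subset_with_card_n by metis
      then have "card (insert v B) = q"
        using q v by (subst card_insert_disjoint) auto
      ultimately have "splits q (insert v V) (\<lambda>X. \<not> R X)"
        using A B v by (intro splitsI[of "\<lambda>A. v \<in> A" _ _ _ "insert v B" A]) auto
      then show ?thesis ..
    next
      case False
      have link_blue: "\<not> R (insert v (insert r S))"
        if r: "r \<in> V - K" and S: "S \<subseteq> K" "Suc (card S) = q" for r S
      proof
        assume red: "R (insert v (insert r S))"
        have all_red: "R (insert v (insert r T))" if "T \<subseteq> K" "Suc (card T) = q" for T
          using link_clique_homogeneous[OF disp q fin v P KV KR r XK X(2) a aP S red that] .
        have "clique (insert r K)"
          unfolding clique_def
        proof (intro conjI allI impI)
          fix A assume A: "A \<subseteq> insert r K" "card A = q"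
          show "R (insert v A)"
          proof (cases "r \<in> A")
            case True
            have "finite A"
              using A q by (metis card.infinite not_numeral_le_zero)
            then have "Suc (card (A - {r})) = q" "A - {r} \<subseteq> K" "insert r (A - {r}) = A"
              using A True card_Suc_Diff1[OF \<open>finite A\<close> True] by auto
            then show ?thesis
              using all_red[of "A - {r}"] by simp
          next
            case False
            then show ?thesis
              using A KR by blast
          qed
        qed (use XK KV r in auto)
        then show False
          using K_max[of "insert r K"] r by auto
      qed
      have blue: "\<not> R (insert r T)"
        if r: "r \<in> V - K" and T: "T \<subseteq> insert v K" "card T = q" for r T
      proof (cases "v \<in> T")
        case True
        have "finite T"
          using T q by (metis card.infinite not_numeral_le_zero)
        then have "Suc (card (T - {v})) = q" "T - {v} \<subseteq> K" "insert v (T - {v}) = T"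
          using T True card_Suc_Diff1[OF \<open>finite T\<close> True] by auto
        then show ?thesis
          using link_blue[OF r, of "T - {v}"] by (metis insert_commute)
      next
        case False
        then have TK: "T \<subseteq> K"
          using T by auto
        have finT: "finite T"
          using T q by (metis card.infinite not_numeral_le_zero)
        obtain y y' where y: "y \<in> T" "y' \<in> T" "y \<noteq> y'"
          using T q by (metis card_le_Suc0_iff_eq finT not_less_eq_eq numeral_2_eq_2)
        let ?Z = "insert v (insert r T)"
        have ne: "r \<notin> T" "r \<noteq> v" "v \<notin> T"
          using r TK v KV by auto
        have Z: "?Z \<subseteq> insert v V" "card ?Z = Suc (Suc q)"
          using TK KV r T ne finT by auto
        \<comment> \<open>These are at least two blue subsets of \<open>v + r + T\<close>; since
          \<open>v + T\<close> is red, \<open>r + T\<close> cannot be a second red one.\<close>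
        have "\<not> R (?Z - {x})" if "x \<in> T" for x
        proof -
          have "?Z - {x} = insert v (insert r (T - {x}))"
            using that ne by auto
          moreover have "Suc (card (T - {x})) = q" "T - {x} \<subseteq> K"
            using T TK card_Suc_Diff1[OF finT that] by auto
          ultimately show ?thesis
            using link_blue[OF r] by simp
        qed
        moreover have "?Z - {v} = insert r T" "?Z - {r} = insert v T"
          using ne by auto
        ultimately show ?thesis
          using dispD[OF disp Z, of v r y y'] y ne KR[OF TK T(2)] by auto
      qed
      \<comment> \<open>By \<open>blue\<close>, no red edge has exactly one vertex outside
        \<open>v + K\<close>, so a red edge with a \<open>q\<close>-subset inside lies inside
        entirely.\<close>
      have "component_union (\<lambda>A. A \<subseteq> insert v K) (Suc q) (insert v V) R"
        unfolding component_union_def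
      proof (intro allI impI ballI)
        fix e x y assume e: "e \<subseteq> insert v V" "card e = Suc q" "R e" and xy: "x \<in> e" "y \<in> e"
        have "e \<subseteq> insert v K" if z: "z \<in> e" "e - {z} \<subseteq> insert v K" for z
        proof (rule ccontr)
          assume "\<not> e \<subseteq> insert v K"
          then have "z \<in> V - K" "insert z (e - {z}) = e"
            using z e by auto
          moreover have "card (e - {z}) = q"
            using z e by (simp add: card_Diff_singleton)
          ultimately show False
            using blue[of z "e - {z}"] z e by simp
        qed
        then show "(e - {x} \<subseteq> insert v K) = (e - {y} \<subseteq> insert v K)"
          using xy by blast
      qed
      moreover obtain r where r: "r \<in> V - K"
        using False KV by auto
      moreover have "q - 1 \<le> card K"
        using card_mono[OF finV[OF KV] XK] X(2) by simp
      then obtain B where B: "B \<subseteq> K" "card B = q - 1" "finite B"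
        using obtain_subset_with_card_n by metis
      then have "card (insert r B) = q"
        using q r by (subst card_insert_disjoint) auto
      moreover have "X - {a} \<subseteq> V" "X - {a} \<subseteq> K" "card (X - {a}) = q"
        using X XK a by auto
      ultimately have "splits q (insert v V) R"
        using v KV r B
        by (intro splitsI[of "\<lambda>A. A \<subseteq> insert v K" _ _ _ "X - {a}" "insert r B"]) auto
      then show ?thesis ..
    qed
  qed
qed

lemma disp_splits:
  assumes "finite V" "disp (Suc q) V R" "q \<ge> 2" "card V \<ge> Suc q"
  shows "splits q V R \<or> splits q V (\<lambda>X. \<not> R X)"
  using assms
proof (induction V rule: finite_induct)
  case (insert v V)
  have dispV: "disp (Suc q) V R"
    using insert.prems disp_subset by blast
  show ?case
  proof (cases "card V \<ge> Suc q")
    case True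
    then consider "splits q V R" | "splits q V (\<lambda>X. \<not> R X)"
      using insert dispV by blast
    then show ?thesis
    proof cases
      case 1
      then show ?thesis
        using splits_insert[of q v V R] insert True by blast
    next
      case 2
      have "disp (Suc q) (insert v V) (\<lambda>X. \<not> R X)"
        using insert.prems(1) by (simp add: disp_Not)
      from splits_insert[OF this insert.prems(2) insert.hyps(1,2) True 2] show ?thesis
        by auto
    qed
  next
    case False
    let ?V = "insert v V"
    have cV: "card ?V = Suc q"
      using False insert by simp
    have finV: "finite ?V"
      using insert by simp
    \<comment> \<open>On \<open>q + 1\<close> vertices the whole set is the only possible edge; the
      colour it lacks has no edges, so every \<open>P\<close> is invariant for it.\<close>
    have only: "component_union P (Suc q) ?V Q" if "\<not> Q ?V" for P Q
      unfolding component_union_def using that cV finV by (metis card_subset_eq)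
    obtain w where w: "w \<in> V"
      using insert cV by fastforce
    have "card (?V - {v}) = q" "card (?V - {w}) = q" "v \<noteq> w"
      using insert.hyps w cV finV by auto
    then have "splits q ?V Q" if "\<not> Q ?V" for Q
      using that by (intro splitsI[of "\<lambda>A. v \<in> A" _ _ _ "?V - {w}" "?V - {v}"] only) auto
    from this[of R] this[of "\<lambda>X. \<not> R X"] show ?thesis
      by argo
  qed
qed simp

section \<open>Disperse hypergraphs\<close>

text \<open>Two edges and two non-edges would put the edge count between 2 and \<open>l - 1\<close>,
  where no value is allowed.\<close>

lemma disperse_imp_disp:
  assumes "l \<ge> 3" "uniform_hypergraph l V E" "disperse l V E"
  shows "disp l V (\<lambda>e. e \<in> E)"
proof -
  have False
    if X: "X \<subseteq> V" "card X = Suc l" and in_X: "a \<in> X" "b \<in> X" "c \<in> X" "d \<in> X"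
      and ne: "a \<noteq> b" "c \<noteq> d"
      and E: "X - {a} \<in> E" "X - {b} \<in> E" "X - {c} \<notin> E" "X - {d} \<notin> E" for X a b c d
  proof -
    have fin: "finite X"
      using X(2) by (metis card.infinite nat.distinct(1))
    let ?F = "{e \<in> E. e \<subseteq> X}"
    have "X \<in> nsets V (l + 1)"
      using X fin by (simp add: nsets_def)
    then have vals: "card ?F \<in> {0, 1, l, l + 1}"
      using assms(3) unfolding disperse_def edges_within_def by blast
    have finF: "finite ?F"
      using fin by simp
    have "X - {a} \<noteq> X - {b}"
      using ne in_X by blast
    then have "card {X - {a}, X - {b}} = 2"
      by simp
    then have low: "2 \<le> card ?F"
      using card_mono[OF finF, of "{X - {a}, X - {b}}"] E by auto
    have "?F \<subseteq> (\<lambda>x. X - {x}) ` (X - {c, d})"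
    proof
      fix e assume e: "e \<in> ?F"
      then have "card e = l"
        using assms(2) unfolding uniform_hypergraph_def nsets_def by auto
      then obtain x where "x \<in> X" "e = X - {x}"
        using delete_point_obtain[OF fin, of e] e X by auto
      then show "e \<in> (\<lambda>x. X - {x}) ` (X - {c, d})"
        using e E by blast
    qed
    then have "card ?F \<le> card (X - {c, d})"
      using fin by (meson card_image_le card_mono finite_Diff finite_imageI order_trans)
    also have "\<dots> = l - 1"
      using in_X ne X fin by (simp add: card_Diff_subset)
    finally show False
      using low vals assms(1) by auto
  qed
  then show ?thesis
    unfolding disp_def by blast
qed

text \<open>Consecutive edges of a tight walk share a \<open>q\<close>-set \<open>S'\<close>, so
  \<open>P\<close> is passed on from edge to edge.\<close>

lemma tightly_connected_not_splits:
  assumes "tightly_connected (Suc q) V E" "finite V" "E \<subseteq> nsets V (Suc q)"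
  shows "\<not> splits q V (\<lambda>e. e \<in> E)"
proof
  assume "splits q V (\<lambda>e. e \<in> E)"
  then obtain P A B where P: "component_union P (Suc q) V (\<lambda>e. e \<in> E)"
    and A: "A \<subseteq> V" "card A = q" and B: "B \<subseteq> V" "card B = q" and ne: "P A \<noteq> P B"
    unfolding splits_def by blast
  have edge: "P S = P T" if "e \<in> E" "S \<subseteq> e" "T \<subseteq> e" "card S = q" "card T = q" for e S T
  proof -
    have e: "e \<subseteq> V" "card e = Suc q" "finite e"
      using that assms by (auto simp: nsets_def)
    have "\<exists>x\<in>e. S = e - {x}" if "S \<subseteq> e" "card S = q" for S
      using delete_point_obtain[OF e(3), of S] that e by metis
    then show ?thesis
      using that e component_unionD[OF P e(1,2)] by metis
  qed
  have walk: "P S = P T"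
    if "tight_walk (Suc q) E es" "S \<subseteq> hd es" "T \<subseteq> last es" "card S = q" "card T = q" for es S T
    using that
  proof (induction es arbitrary: S)
    case Nil
    then show ?case
      by (simp add: tight_walk_def)
  next
    case (Cons e es)
    show ?case
    proof (cases es)
      case Nil
      then show ?thesis
        using edge[of e S T] Cons.prems by (simp add: tight_walk_def)
    next
      case (Cons e' es')
      note w = Cons.prems(1)[unfolded tight_walk_def]
      have "q \<le> card (e \<inter> e')"
        using w[THEN conjunct2, THEN conjunct2, rule_format, of 0] Cons by simp
      then obtain S' where S': "S' \<subseteq> e \<inter> e'" "card S' = q"
        by (meson obtain_subset_with_card_n)
      have "tight_walk (Suc q) E es"
        unfolding tight_walk_def
      proof (intro conjI allI impI)
        fix i assume "i + 1 < length es"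
        then show "Suc q - 1 \<le> card (es ! i \<inter> es ! (i + 1))"
          using w[THEN conjunct2, THEN conjunct2, rule_format, of "Suc i"] by simp
      qed (use w Cons in auto)
      then have "P S' = P T"
        using Cons.IH[of S'] Cons.prems Cons S' by simp
      moreover have "P S = P S'"
        using edge[of e S S'] w Cons.prems S' by auto
      ultimately show ?thesis by simp
    qed
  qed
  have "A \<in> nsets V q" "B \<in> nsets V q"
    using A B assms(2) by (auto simp: nsets_def finite_subset)
  then have "(A, B) \<in> tight_conn (Suc q) V E"
    using assms(1) unfolding tightly_connected_def by simp
  then show False
    using walk A B ne unfolding tight_conn_def by blast
qed

text \<open>A tight walk has at least one edge, which already occupies \<open>l\<close>
  vertices.\<close>

lemma tightly_connected_imp_card:
  assumes "tightly_connected l V E" "finite V" "E \<subseteq> nsets V l"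
  shows "card V \<ge> l"
proof -
  obtain A where "A \<in> nsets V (l - 1)"
    using assms(1) unfolding tightly_connected_def by blast
  then obtain es where "tight_walk l E es"
    using assms(1) unfolding tightly_connected_def tight_conn_def by blast
  then obtain e where "e \<in> E"
    unfolding tight_walk_def by (metis hd_in_set subsetD)
  then have "e \<subseteq> V" "card e = l"
    using assms(3) by (auto simp: nsets_def)
  then show ?thesis
    using card_mono[OF assms(2)] by blast
qed

theorem theorem1p4:
  fixes l :: nat and V :: "'a set" and E :: "'a set set"
  assumes "l \<ge> 3"
    and "uniform_hypergraph l V E"
    and "disperse l V E"
  shows "\<not> tightly_connected l V E \<or> \<not> tightly_connected l V (complement_edges l V E)"
proof (rule ccontr)
  assume "\<not> ?thesis"
  then have red: "tightly_connected l V E" and blue: "tightly_connected l V (complement_edges l V E)"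
    by auto
  obtain q where l: "l = Suc q"
    using assms(1) by (cases l) auto
  have V: "finite V" "E \<subseteq> nsets V l" "complement_edges l V E \<subseteq> nsets V l"
    using assms(2) by (auto simp: uniform_hypergraph_def complement_edges_def)
  have "splits q V (\<lambda>e. e \<in> E) \<or> splits q V (\<lambda>e. e \<notin> E)"
    using disp_splits[of V q "\<lambda>e. e \<in> E"] disperse_imp_disp[OF assms] assms(1) l V
      tightly_connected_imp_card[OF red V(1,2)] by simp
  \<comment> \<open>Complement edges lie outside \<open>E\<close>, so invariance over all
    non-members of \<open>E\<close> covers them.\<close>
  moreover have "component_union P (Suc q) V (\<lambda>e. e \<in> complement_edges l V E)"
    if "component_union P (Suc q) V (\<lambda>e. e \<notin> E)" for P
    using that unfolding component_union_def complement_edges_def by blast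
  then have "splits q V (\<lambda>e. e \<in> complement_edges l V E)" if "splits q V (\<lambda>e. e \<notin> E)"
    using that unfolding splits_def by blast
  ultimately show False
    using tightly_connected_not_splits red blue V l by blast
qed

end
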